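(* Let $F$ be a field with $\operatorname{char}(F)\neq 2$ and let $L$ be a finite dimensional Lie algebra over $F$. Then $b(L)=1$ if and only if $\dim [L,L]=1$.
   Context: For a finite dimensional Lie algebra $L$ and $x\in L$, $\operatorname{ad}_x:L\to L$ denotes the map $y\mapsto [x,y]$. The breadth of $L$ is $b(L)=\max\{\operatorname{rank}(\operatorname{ad}_x)\mid x\in L\}$. *)

theory Defs
  imports Complex_Main
begin

locale lie_algebra = vector_space scale
  for scale :: "'f::field \<Rightarrow> 'a::ab_group_add \<Rightarrow> 'a" (infixr "*s" 75) +
  fixes bracket :: "'a \<Rightarrow> 'a \<Rightarrow> 'a"
  assumes linear_bracket_left: "Vector_Spaces.linear scale scale (\<lambda>x. bracket x y)"
    and linear_bracket_right: "Vector_Spaces.linear scale scale (\<lambda>y. bracket x y)"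
    and bracket_self: "bracket x x = 0"
    and jacobi: "bracket x (bracket y z) + bracket y (bracket z x) + bracket z (bracket x y) = 0"
begin

definition ad :: "'a \<Rightarrow> 'a \<Rightarrow> 'a"
  where "ad x = (\<lambda>y. bracket x y)"

definition derived_algebra :: "'a set"
  where "derived_algebra = span {bracket x y | x y. True}"

end

(* The locale finite_dimensional_vector_space would fix a distinguished basis as a parameter;
   here finite dimensionality is only the existence of a finite spanning set. *)
locale fin_dim_lie_algebra = lie_algebra +
  assumes finite_dim: "\<exists>B. finite B \<and> span B = UNIV"
begin

(* The rank of a linear endomorphism is the dimension of its image. The set of ranks is
   nonempty, and bounded by the dimension of the algebra, so that Max is the true maximum. *)
definition breadth :: nat
  where "breadth = Max {dim (range (ad x)) | x. True}"

end

end

theory Submission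
  imports Defs
begin

text \<open>
  The breadth and the dimension of the derived algebra are both positive exactly when some bracket
  is nonzero, so the statement reduces to showing that one of them is at most 1 if and only if the
  other is.

  Every \<open>range (ad x)\<close> lies in the derived algebra, which therefore bounds the breadth by
  its dimension. Conversely, let every \<open>range (ad x)\<close> have dimension at most 1, and fix a
  nonzero bracket \<open>c = [a,b]\<close>. Any nonzero element of \<open>range (ad x)\<close> spans it, so
  \<open>range (ad a)\<close> and, by antisymmetry, \<open>range (ad b)\<close> are the line of \<open>c\<close>;
  in particular \<open>[x,b]\<close> is a multiple of \<open>c\<close> for every \<open>x\<close>. If
  \<open>[x,b]\<close> is nonzero, then \<open>range (ad x)\<close> is the line of \<open>c\<close> too. If it
  vanishes, then \<open>[x + a, b] = c\<close>, so \<open>range (ad (x + a))\<close> is the line of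
  \<open>c\<close>, and \<open>ad x = ad (x + a) - ad a\<close> takes its values there. Thus all brackets
  lie in \<open>span {c}\<close> (\<open>bracket_in_span_of_nonzero_bracket\<close>), and with them the
  derived algebra.
\<close>

context lie_algebra
begin

lemma bracket_add_left: "bracket (x + y) z = bracket x z + bracket y z"
  using Vector_Spaces.linear.axioms(3)[OF linear_bracket_left, of z]
  by (simp add: module_hom_iff)

lemma bracket_add_right: "bracket x (y + z) = bracket x y + bracket x z"
  using Vector_Spaces.linear.axioms(3)[OF linear_bracket_right, of x]
  by (simp add: module_hom_iff)

lemma bracket_antisym: "bracket y x = - bracket x y"
proof -
  have "bracket (x + y) (x + y) = bracket y x + bracket x y"
    by (simp only: bracket_add_left bracket_add_right) (simp add: bracket_self)
  then have "bracket y x + bracket x y = 0"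
    by (simp only: bracket_self)
  then show ?thesis
    by (simp only: eq_neg_iff_add_eq_0)
qed

lemma subspace_range_ad: "subspace (range (ad x))"
  unfolding ad_def
  using module_hom.subspace_image[OF Vector_Spaces.linear.axioms(3)[OF linear_bracket_right]]
  by simp

lemma bracket_in_range_ad: "bracket x y \<in> range (ad x)"
  by (simp add: ad_def)

lemma bracket_in_derived_algebra: "bracket x y \<in> derived_algebra"
  unfolding derived_algebra_def by (blast intro: span_base)

lemma derived_algebra_subset_iff:
  assumes "subspace S"
  shows "derived_algebra \<subseteq> S \<longleftrightarrow> (\<forall>x y. bracket x y \<in> S)"
  using assms bracket_in_derived_algebra span_minimal[of "{bracket x y |x y. True}" S]
  unfolding derived_algebra_def by blast

end

context fin_dim_lie_algebra
begin

text \<open>The library develops the monotonicity of the dimension for spaces with a distinguished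
  finite basis; choosing one inside a finite spanning set makes it available here.\<close>

lemma exists_finite_basis: "\<exists>B. finite_dimensional_vector_space scale B"
proof -
  obtain S where S: "finite S" "span S = UNIV"
    using finite_dim by blast
  obtain B where B: "B \<subseteq> S" "independent B" "S \<subseteq> span B"
    using maximal_independent_subset[of S] by blast
  have "span B = UNIV"
    using S(2) B(3) span_minimal[of S "span B"] by auto
  moreover have "finite B"
    using B(1) S(1) by (rule finite_subset)
  ultimately have "finite_dimensional_vector_space scale B"
    using B(2) by unfold_locales auto
  then show ?thesis ..
qed

lemma dim_mono:
  assumes "S \<subseteq> T"
  shows "dim S \<le> dim T"
proof -
  obtain B where "finite_dimensional_vector_space scale B"
    using exists_finite_basis by blast
  then interpret finite_dimensional_vector_space scale B .
  show ?thesis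
    using assms by (rule dim_subset)
qed

lemma dim_span_singleton: "c \<noteq> 0 \<Longrightarrow> dim (span {c}) = 1"
  using dim_eq_card[of "{c}" "span {c}"] by (simp add: span_span)

lemma dim_ge_1_if_nonzero_mem:
  assumes "subspace S" "c \<in> S" "c \<noteq> 0"
  shows "1 \<le> dim S"
  using dim_mono[of "span {c}" S] span_minimal[of "{c}" S] dim_span_singleton[of c] assms
  by simp

lemma subset_span_of_nonzero_mem:
  assumes "subspace S" "dim S \<le> 1" "c \<in> S" "c \<noteq> 0"
  shows "S \<subseteq> span {c}"
proof -
  obtain B where "finite_dimensional_vector_space scale B"
    using exists_finite_basis by blast
  then interpret finite_dimensional_vector_space scale B .
  have "span {c} = S"
    using assms dim_span_singleton[of c] span_minimal[of "{c}" S]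
    by (intro subspace_dim_equal) auto
  then show ?thesis
    by simp
qed

text \<open>The maximum defining the breadth is taken over a set of natural numbers that is
  bounded by the dimension of the algebra, so it has the order-theoretic meaning of a maximum.\<close>

lemma breadth_le_iff: "breadth \<le> n \<longleftrightarrow> (\<forall>x. dim (range (ad x)) \<le> n)"
proof -
  have "{dim (range (ad x)) |x. True} \<subseteq> {..dim UNIV}"
    using dim_mono[OF subset_UNIV] by auto
  then have "finite {dim (range (ad x)) |x. True}"
    using finite_subset by blast
  then show ?thesis
    unfolding breadth_def by (subst Max_le_iff) auto
qed

lemma dim_derived_algebra_ge_1_iff: "1 \<le> dim derived_algebra \<longleftrightarrow> (\<exists>x y. bracket x y \<noteq> 0)"
proof
  assume dim_ge: "1 \<le> dim derived_algebra"
  show "\<exists>x y. bracket x y \<noteq> 0"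
  proof (rule ccontr)
    assume "\<nexists>x y. bracket x y \<noteq> 0"
    then have "derived_algebra \<subseteq> span {}"
      by (simp add: derived_algebra_subset_iff subspace_span)
    then show False
      using dim_ge dim_mono[of derived_algebra "span {}"] dim_eq_card[of "{}" "{0}"] independent_empty
      by simp
  qed
next
  assume "\<exists>x y. bracket x y \<noteq> 0"
  then show "1 \<le> dim derived_algebra"
    using dim_ge_1_if_nonzero_mem[OF _ bracket_in_derived_algebra]
    by (auto simp: derived_algebra_def)
qed

lemma breadth_ge_1_iff: "1 \<le> breadth \<longleftrightarrow> (\<exists>x y. bracket x y \<noteq> 0)"
proof
  assume "1 \<le> breadth"
  then obtain x where "1 \<le> dim (range (ad x))"
    using breadth_le_iff[of 0] by (auto simp: Suc_le_eq)
  moreover have "range (ad x) \<subseteq> derived_algebra"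
    using bracket_in_derived_algebra by (auto simp: ad_def)
  ultimately show "\<exists>x y. bracket x y \<noteq> 0"
    using dim_derived_algebra_ge_1_iff dim_mono order_trans by blast
next
  assume "\<exists>x y. bracket x y \<noteq> 0"
  then obtain x y where "bracket x y \<noteq> 0"
    by blast
  then have "1 \<le> dim (range (ad x))"
    using dim_ge_1_if_nonzero_mem[OF subspace_range_ad bracket_in_range_ad] by blast
  then show "1 \<le> breadth"
    using breadth_le_iff order.refl order_trans by blast
qed

text \<open>Adding \<open>a\<close> to \<open>x\<close> repairs the only case in which \<open>[x,b]\<close> fails to
  determine the line containing \<open>range (ad x)\<close>, namely \<open>[x,b] = 0\<close>.\<close>

lemma bracket_in_span_of_nonzero_bracket:
  assumes breadth_le: "breadth \<le> 1"
    and nonzero: "bracket a b \<noteq> 0"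
  shows "bracket x y \<in> span {bracket a b}"
proof -
  define c where "c = bracket a b"
  have range_ad_subset: "range (ad u) \<subseteq> span {d}" if "d \<in> range (ad u)" "d \<noteq> 0" for u d
    using subset_span_of_nonzero_mem[OF subspace_range_ad _ that] breadth_le breadth_le_iff by blast
  have in_span_c: "bracket u v \<in> span {c}" if "c \<in> range (ad u)" for u v
    using range_ad_subset[OF that] nonzero bracket_in_range_ad by (auto simp: c_def)
  have ad_a: "bracket a v \<in> span {c}" for v
    using bracket_in_range_ad[of a b] by (intro in_span_c) (simp add: c_def)
  have "c \<in> range (ad b)"
    using subspace_neg[OF subspace_range_ad bracket_in_range_ad[of b a]] bracket_antisym[of a b]
    by (simp add: c_def)
  then have "bracket x b \<in> span {c}"
    using in_span_c[of b x] bracket_antisym[of x b] span_neg by auto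
  have "bracket x y \<in> span {c}"
  proof (cases "bracket x b = 0")
    case True
    then have "bracket (x + a) b = c"
      by (simp add: bracket_add_left c_def)
    then have "bracket (x + a) y \<in> span {c}"
      using bracket_in_range_ad[of "x + a" b] by (intro in_span_c) simp
    then have "bracket (x + a) y - bracket a y \<in> span {c}"
      using ad_a by (rule span_diff)
    then show ?thesis
      by (simp add: bracket_add_left)
  next
    case False
    then have "bracket x y \<in> span {bracket x b}"
      using range_ad_subset[OF bracket_in_range_ad] bracket_in_range_ad by blast
    moreover have "span {bracket x b} \<subseteq> span {c}"
      using \<open>bracket x b \<in> span {c}\<close> by (intro span_minimal) auto
    ultimately show ?thesis
      by blast
  qed
  then show ?thesis
    by (simp add: c_def)
qed

lemma breadth_le_1_iff_dim_derived_algebra_le_1: "breadth \<le> 1 \<longleftrightarrow> dim derived_algebra \<le> 1"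
proof
  assume breadth_le: "breadth \<le> 1"
  show "dim derived_algebra \<le> 1"
  proof (cases "\<exists>a b. bracket a b \<noteq> 0")
    case True
    then obtain a b where nonzero: "bracket a b \<noteq> 0"
      by blast
    then have "derived_algebra \<subseteq> span {bracket a b}"
      using bracket_in_span_of_nonzero_bracket[OF breadth_le]
      by (simp add: derived_algebra_subset_iff)
    then show ?thesis
      using dim_mono[of derived_algebra "span {bracket a b}"] dim_span_singleton[OF nonzero]
      by linarith
  next
    case False
    then show ?thesis
      using dim_derived_algebra_ge_1_iff nat_le_linear[of "dim derived_algebra" 1] by simp
  qed
next
  assume dim_le: "dim derived_algebra \<le> 1"
  have "dim (range (ad x)) \<le> dim derived_algebra" for x
    using bracket_in_derived_algebra by (intro dim_mono) (auto simp: ad_def)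
  then show "breadth \<le> 1"
    using dim_le order_trans by (fastforce simp only: breadth_le_iff)
qed

end

theorem theorem2p4:
  fixes scale :: "'f::field \<Rightarrow> 'a::ab_group_add \<Rightarrow> 'a"
    and bracket :: "'a \<Rightarrow> 'a \<Rightarrow> 'a"
  assumes "CHAR('f) \<noteq> 2"
    and "fin_dim_lie_algebra scale bracket"
  shows "fin_dim_lie_algebra.breadth scale bracket = 1 \<longleftrightarrow>
    vector_space.dim scale (lie_algebra.derived_algebra scale bracket) = 1"
proof -
  interpret fin_dim_lie_algebra scale bracket
    by (rule assms(2))
  show ?thesis
    unfolding order.eq_iff[of _ "1::nat"]
    using breadth_le_1_iff_dim_derived_algebra_le_1 breadth_ge_1_iff dim_derived_algebra_ge_1_iff
    by blast
qed

end
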